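(* Let $d\geq 2$ be an integer. There exist a doubling measure $\nu$ on $\mathbb{R}^d$ and a rectifiable curve $\gamma:[0,1]\to\mathbb{R}^d$ with image $\Gamma=\gamma([0,1])$ such that $\nu(\Gamma)>0$.
   Context: For $x\in\mathbb{R}^d$ and $r>0$ let $B(x,r)=\{y\in\mathbb{R}^d: |y-x|<r\}$. A Borel measure $\nu$ on $\mathbb{R}^d$, finite on every ball, is called doubling if there is a constant $C_\nu<\infty$ such that $\nu(B(x,2r))\leq C_\nu\,\nu(B(x,r))$ for all $x\in\mathbb{R}^d$ and all $0<r<\infty$. A rectifiable curve is a continuous map $\gamma:[0,1]\to\mathbb{R}^d$ with $$\operatorname{length}(\gamma):=\sup_{0\leq t_0\leq\cdots\leq t_n\leq 1}\ \sum_{j=1}^n|\gamma(t_j)-\gamma(t_{j-1})|<\infty,$$ the supremum being over all $n$ and all such finite sequences. *)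

theory Defs
  imports "HOL-Analysis.Analysis"
begin

definition doubling_measure :: "'a::real_normed_vector measure \<Rightarrow> bool" where
  "doubling_measure \<nu> \<longleftrightarrow>
     sets \<nu> = sets borel \<and>
     (\<forall>x. \<forall>r>0. emeasure \<nu> (ball x r) < \<infinity>) \<and>
     (\<exists>C::real. \<forall>x. \<forall>r>0.
        emeasure \<nu> (ball x (2 * r)) \<le> ennreal C * emeasure \<nu> (ball x r))"

definition curve_length :: "(real \<Rightarrow> 'a::metric_space) \<Rightarrow> ennreal" where
  "curve_length \<gamma> =
     (SUP (n, t) \<in> {(n::nat, t::nat \<Rightarrow> real). mono_on {0..n} t \<and> t ` {0..n} \<subseteq> {0..1}}.
        \<Sum>j=1..n. ennreal (dist (\<gamma> (t j)) (\<gamma> (t (j - 1)))))"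

definition rectifiable_curve :: "(real \<Rightarrow> 'a::metric_space) \<Rightarrow> bool" where
  "rectifiable_curve \<gamma> \<longleftrightarrow> path \<gamma> \<and> curve_length \<gamma> < \<infinity>"

end

theory Submission
  imports Defs
begin

text \<open>
  The measure is a product of \<open>d\<close> copies of a one-dimensional multiplicative cascade. The cascade
  distributes the mass of each triadic interval among its three children in the proportions
  \<open>\<delta>, 1 - 2\<delta>, \<delta>\<close>. Since the two outer proportions agree, adjacent triadic intervals of equal
  length always have masses within the factor \<open>(1 - 2\<delta>) / \<delta>\<close> of each other, even when their
  common ancestor is far up; this makes the cascade and its powers doubling, however small \<open>\<delta>\<close> is
  (\<open>cdf_doubling\<close>, \<open>doubling_measure_cascade\<close>). As \<open>\<delta>\<close> tends to 0, the
  cascade concentrates on points nearly all of whose ternary digits are 1, and the dimension of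
  the product tends to 0. Once it is below 1, a rectifiable curve can pass through a set of
  positive measure.

  To make this quantitative, charge a price of \<open>2 * 3 ^ d\<close> for each digit different from 1 and of 1
  for each digit 1, and let prices multiply. For small \<open>\<delta>\<close> the mean price per digit is below \<open>r = (3/2) powr (1/d)\<close>, so by Markov's inequality and
  a union bound over the scales there are a constant \<open>C\<close> and a set \<open>A\<close> of positive cascade measure
  on which the first \<open>m\<close> digits cost at most \<open>C * r ^ m\<close>, for every \<open>m\<close>
  (\<open>digit_prod_bounded_on_positive_set\<close>). The set to be charged is \<open>A ^ d\<close>.

  The curve is built backwards, as the inverse of a function \<open>T\<close> from \<open>A ^ d\<close> to \<open>[0, 1]\<close>. Read a
  point of the cube as a sequence of letters, the letter number \<open>j\<close> being the vector of the
  \<open>j\<close>-th ternary digits of the coordinates, and let \<open>T\<close> be the coding of such sequences by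
  nested intervals in which the central letter \<open>(1, ..., 1)\<close> selects the first half of the current
  interval and every other letter selects a short subinterval of the second half, with gaps
  between them. On \<open>A ^ d\<close> the \<open>m\<close>-th interval has length at least a constant times \<open>3 ^ (-m)\<close>,
  which is the scale of the \<open>m\<close>-th triadic cube. Hence points of \<open>A ^ d\<close> that separate at stage
  \<open>m\<close> have images at distance at least a constant times \<open>3 ^ (-m)\<close>, and the inverse of \<open>T\<close> is Lipschitz
  (\<open>digit_code_separates\<close>). A Lipschitz extension of this inverse to the line is a
  rectifiable curve through all of \<open>A ^ d\<close> (\<open>rectifiable_curve_covers\<close>).
\<close>

section \<open>A singular doubling distribution function on the line\<close>

text \<open>
  The integer \<open>k\<close> stands for the triadic interval from \<open>k / 3 ^ n\<close> to \<open>(k + 1) / 3 ^ n\<close>, whose parent is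
  \<open>k div 3\<close>. Indexing by integers, with floor division, extends the cascade from the unit interval to
  the whole line with period 1.
\<close>

primrec digit_prod :: "(int \<Rightarrow> real) \<Rightarrow> nat \<Rightarrow> int \<Rightarrow> real" where
  "digit_prod f 0 k = 1"
| "digit_prod f (Suc n) k = digit_prod f n (k div 3) * f (k mod 3)"

definition weight :: "real \<Rightarrow> int \<Rightarrow> real" where
  "weight \<delta> i = (if i = 1 then 1 - 2 * \<delta> else \<delta>)"

text \<open>
  The value of the distribution function at the grid point \<open>k / 3 ^ n\<close>, normalised to vanish at 0. The
  parenthesised factor is the proportion of the parent's mass that lies to the left of the child \<open>k mod 3\<close>.
\<close>

primrec cdf_grid :: "real \<Rightarrow> nat \<Rightarrow> int \<Rightarrow> real" where
  "cdf_grid \<delta> 0 k = of_int k"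
| "cdf_grid \<delta> (Suc n) k = cdf_grid \<delta> n (k div 3) +
     digit_prod (weight \<delta>) n (k div 3) * (if k mod 3 = 0 then 0 else if k mod 3 = 1 then \<delta> else 1 - \<delta>)"

text \<open>
  The approximations increase with \<open>n\<close>, and at a grid point they are constant from some \<open>n\<close> on.
\<close>

definition cdf :: "real \<Rightarrow> real \<Rightarrow> real" where
  "cdf \<delta> x = (SUP n. cdf_grid \<delta> n \<lfloor>3 ^ n * x\<rfloor>)"

lemma digit_prod_pos:
  assumes "\<And>i. 0 < f i"
  shows "0 < digit_prod f n k"
  by (induction n arbitrary: k) (auto simp: assms)

lemma div_mod_3_cases:
  fixes k :: int
  obtains "k mod 3 = 0" "(k + 1) div 3 = k div 3" "(k + 1) mod 3 = 1"
  | "k mod 3 = 1" "(k + 1) div 3 = k div 3" "(k + 1) mod 3 = 2"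
  | "k mod 3 = 2" "(k + 1) div 3 = k div 3 + 1" "(k + 1) mod 3 = 0"
proof -
  have "k mod 3 = 0 \<and> (k + 1) div 3 = k div 3 \<and> (k + 1) mod 3 = 1 \<or>
        k mod 3 = 1 \<and> (k + 1) div 3 = k div 3 \<and> (k + 1) mod 3 = 2 \<or>
        k mod 3 = 2 \<and> (k + 1) div 3 = k div 3 + 1 \<and> (k + 1) mod 3 = 0"
    by presburger
  then show thesis using that by satx
qed

lemma cdf_grid_Suc_diff:
  "cdf_grid \<delta> n (k + 1) - cdf_grid \<delta> n k = digit_prod (weight \<delta>) n k"
proof (induction n arbitrary: k)
  case (Suc n)
  show ?case
    by (rule div_mod_3_cases[of k])
       (use Suc[of "k div 3"] in \<open>simp_all add: weight_def[of _ 0] weight_def[of _ 1] weight_def[of _ 2] algebra_simps\<close>)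
qed simp

context
  fixes \<delta> :: real
  assumes delta: "0 < \<delta>" "\<delta> < 1 / 3"
begin

lemma weight_pos: "0 < weight \<delta> i"
  using delta by (simp add: weight_def)

lemma cdf_grid_mono: "j \<le> k \<Longrightarrow> cdf_grid \<delta> n j \<le> cdf_grid \<delta> n k"
proof (induction k rule: int_ge_induct)
  case (step k)
  then show ?case
    using cdf_grid_Suc_diff[of \<delta> n k] digit_prod_pos[of "weight \<delta>" n k, OF weight_pos] by linarith
qed simp

lemma cdf_grid_refine: "cdf_grid \<delta> (n + m) (3 ^ m * k) = cdf_grid \<delta> n k"
  by (induction m) (simp_all add: mult.assoc)

lemma cdf_grid_floor_le:
  fixes x :: real
  assumes "x \<le> of_int k / 3 ^ n"
  shows "cdf_grid \<delta> m \<lfloor>3 ^ m * x\<rfloor> \<le> cdf_grid \<delta> n k"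
proof -
  have "cdf_grid \<delta> m \<lfloor>3 ^ m * x\<rfloor> = cdf_grid \<delta> (m + n) (3 ^ n * \<lfloor>3 ^ m * x\<rfloor>)"
    by (simp add: cdf_grid_refine)
  also have "\<dots> \<le> cdf_grid \<delta> (m + n) (3 ^ m * k)"
  proof (rule cdf_grid_mono)
    have "real_of_int (3 ^ n * \<lfloor>3 ^ m * x\<rfloor>) \<le> 3 ^ n * (3 ^ m * x)"
      by simp
    also have "\<dots> \<le> real_of_int (3 ^ m * k)"
      using assms by (simp add: field_simps)
    finally show "3 ^ n * \<lfloor>3 ^ m * x\<rfloor> \<le> 3 ^ m * k"
      by linarith
  qed
  also have "\<dots> = cdf_grid \<delta> n k"
    using cdf_grid_refine[of n m k] by (simp add: add.commute)
  finally show ?thesis .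
qed

lemma cdf_le_grid: "x \<le> of_int k / 3 ^ n \<Longrightarrow> cdf \<delta> x \<le> cdf_grid \<delta> n k"
  unfolding cdf_def by (intro cSUP_least cdf_grid_floor_le) auto

lemma grid_le_cdf:
  assumes "of_int k / 3 ^ n \<le> x"
  shows "cdf_grid \<delta> n k \<le> cdf \<delta> x"
proof -
  have "k \<le> \<lfloor>3 ^ n * x\<rfloor>"
    using assms by (simp add: le_floor_iff field_simps)
  then have "cdf_grid \<delta> n k \<le> cdf_grid \<delta> n \<lfloor>3 ^ n * x\<rfloor>"
    by (rule cdf_grid_mono)
  also have "\<dots> \<le> cdf \<delta> x"
    unfolding cdf_def
  proof (rule cSUP_upper)
    show "bdd_above (range (\<lambda>n. cdf_grid \<delta> n \<lfloor>3 ^ n * x\<rfloor>))"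
      using cdf_grid_floor_le[of x "\<lceil>x\<rceil>" 0] by (intro bdd_aboveI2) auto
  qed simp
  finally show ?thesis .
qed

lemma cdf_grid_point: "cdf \<delta> (of_int k / 3 ^ n) = cdf_grid \<delta> n k"
  by (intro antisym cdf_le_grid grid_le_cdf) auto

lemma cdf_mono: 
  assumes "x \<le> y"
  shows "cdf \<delta> x \<le> cdf \<delta> y"
  unfolding cdf_def
proof (rule cSUP_mono)
  show "bdd_above (range (\<lambda>n. cdf_grid \<delta> n \<lfloor>3 ^ n * y\<rfloor>))"
    using cdf_grid_floor_le[of y "\<lceil>y\<rceil>" 0] by (intro bdd_aboveI2) auto
  show "\<exists>m\<in>UNIV. cdf_grid \<delta> n \<lfloor>3 ^ n * x\<rfloor> \<le> cdf_grid \<delta> m \<lfloor>3 ^ m * y\<rfloor>" for n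
    using assms by (intro bexI[of _ n] cdf_grid_mono floor_mono) auto
qed simp

lemma abs_cdf_diff_le: "\<bar>cdf \<delta> x - x\<bar> \<le> 1"
  using cdf_le_grid[of x "\<lfloor>x\<rfloor> + 1" 0] grid_le_cdf[of "\<lfloor>x\<rfloor>" 0 x] by (simp add: abs_le_iff) linarith

lemma cell_weight_le: "digit_prod (weight \<delta>) n k \<le> (1 - 2 * \<delta>) ^ n"
proof (induction n arbitrary: k)
  case (Suc n)
  then show ?case
    using digit_prod_pos[of "weight \<delta>" n "k div 3", OF weight_pos] delta weight_pos[of "k mod 3"]
    by (auto simp: weight_def mult.commute[of "1 - 2*\<delta>"] intro!: mult_mono)
qed simp

text \<open>
  No cell at level \<open>n\<close> has more mass than \<open>(1 - 2\<delta>) ^ n\<close>, and points closer than \<open>3 ^ (-n)\<close> lie in three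
  consecutive cells.
\<close>

lemma continuous_cdf: "isCont (cdf \<delta>) x"
proof (unfold continuous_at_eps_delta, intro allI impI)
  fix e :: real assume "e > 0"
  moreover have "(\<lambda>n. 3 * (1 - 2 * \<delta>) ^ n) \<longlonglongrightarrow> 3 * 0"
    using delta by (intro tendsto_mult tendsto_const LIMSEQ_power_zero) auto
  ultimately obtain n where n: "3 * (1 - 2 * \<delta>) ^ n < e"
    using order_tendstoD(2)[of "\<lambda>n. 3 * (1 - 2 * \<delta>) ^ n" "3 * 0" sequentially e]
    by (auto simp: eventually_sequentially)
  define k where "k = \<lfloor>3 ^ n * x\<rfloor>"
  have k: "of_int k \<le> 3 ^ n * x" "3 ^ n * x < of_int k + 1"
    by (auto simp: k_def)
  have sum3: "cdf_grid \<delta> n (k + 2) - cdf_grid \<delta> n (k - 1) \<le> 3 * (1 - 2 * \<delta>) ^ n"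
    using cdf_grid_Suc_diff[of \<delta> n "k - 1"] cdf_grid_Suc_diff[of \<delta> n k] cdf_grid_Suc_diff[of \<delta> n "k + 1"]
      cell_weight_le[of n "k - 1"] cell_weight_le[of n k] cell_weight_le[of n "k + 1"] by (simp add: add.assoc)
  have bounds: "cdf_grid \<delta> n (k - 1) \<le> cdf \<delta> y \<and> cdf \<delta> y \<le> cdf_grid \<delta> n (k + 2)"
    if "\<bar>y - x\<bar> < 1 / 3 ^ n" for y
  proof -
    have "\<bar>3 ^ n * y - 3 ^ n * x\<bar> = 3 ^ n * \<bar>y - x\<bar>"
      by (simp add: abs_mult flip: right_diff_distrib)
    also have "\<dots> < 1"
      using that by (simp add: field_simps)
    finally have "of_int (k - 1) \<le> 3 ^ n * y" "3 ^ n * y \<le> of_int (k + 2)"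
      using k by auto
    then show ?thesis
      by (intro conjI grid_le_cdf cdf_le_grid) (simp_all add: field_simps)
  qed
  show "\<exists>d>0. \<forall>y. dist y x < d \<longrightarrow> dist (cdf \<delta> y) (cdf \<delta> x) < e"
  proof (intro exI[of _ "1 / 3 ^ n"] conjI allI impI)
    fix y assume "dist y x < 1 / 3 ^ n"
    then show "dist (cdf \<delta> y) (cdf \<delta> x) < e"
      using bounds[of y] bounds[of x] sum3 n by (auto simp: dist_real_def)
  qed simp
qed

text \<open>
  If two adjacent cells are siblings, their masses are in the ratio of two of the weights. Otherwise
  they are the last child of one cell and the first child of the next; these receive the same
  proportion \<open>\<delta>\<close>, so the ratio is inherited from the parents.
\<close>

lemma cell_weight_neighbours:
  defines "A \<equiv> (1 - 2 * \<delta>) / \<delta>"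
  shows "digit_prod (weight \<delta>) n (k + 1) \<le> A * digit_prod (weight \<delta>) n k \<and>
         digit_prod (weight \<delta>) n k \<le> A * digit_prod (weight \<delta>) n (k + 1)"
proof (induction n arbitrary: k)
  case 0
  show ?case using delta by (simp add: A_def field_simps)
next
  case (Suc n)
  have vals: "weight \<delta> 0 = \<delta>" "weight \<delta> 1 = 1 - 2 * \<delta>" "weight \<delta> 2 = \<delta>"
    by (simp_all add: weight_def)
  define p where "p = digit_prod (weight \<delta>) n (k div 3)"
  have p: "0 < p"
    unfolding p_def by (intro digit_prod_pos weight_pos)
  have "A * \<delta> = 1 - 2 * \<delta>"
    using delta by (simp add: A_def)
  then have centre: "p * (1 - 2 * \<delta>) \<le> A * (p * \<delta>)"
    by (simp add: mult.left_commute[of A])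
  have "p * \<delta> \<le> p * (1 - 2 * \<delta>)"
    using p delta by (intro mult_left_mono) auto
  also have "\<dots> \<le> A * (p * (1 - 2 * \<delta>))"
    using p delta mult_right_mono[of 1 A "p * (1 - 2 * \<delta>)"] by (simp add: A_def field_simps)
  finally have edge: "p * \<delta> \<le> A * (p * (1 - 2 * \<delta>))" .
  show ?case
  proof (rule div_mod_3_cases[of k])
    assume "k mod 3 = 2" "(k + 1) div 3 = k div 3 + 1" "(k + 1) mod 3 = 0"
    then show ?thesis
      using Suc[of "k div 3"] delta by (simp add: vals mult.assoc[symmetric] mult_right_mono)
  qed (use centre edge in \<open>simp_all add: vals flip: p_def\<close>)
qed

lemma cell_weight_shift:
  defines "A \<equiv> (1 - 2 * \<delta>) / \<delta>"
  shows "digit_prod (weight \<delta>) n (k + int i) \<le> A ^ i * digit_prod (weight \<delta>) n k \<and>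
         digit_prod (weight \<delta>) n (k - int i) \<le> A ^ i * digit_prod (weight \<delta>) n k"
proof (induction i)
  case (Suc i)
  define W where "W = digit_prod (weight \<delta>) n"
  have A: "0 \<le> A" using delta by (simp add: A_def)
  have nb: "W (j + 1) \<le> A * W j" "W j \<le> A * W (j + 1)" for j
    using cell_weight_neighbours[of n j] by (simp_all add: A_def W_def)
  have "W (k + int (Suc i)) \<le> A * W (k + int i)"
    using nb(1)[of "k + int i"] by (simp add: ac_simps)
  also have "\<dots> \<le> A * (A ^ i * W k)"
    using A Suc by (intro mult_left_mono) (auto simp: W_def)
  finally have up: "W (k + int (Suc i)) \<le> A ^ Suc i * W k"
    by (simp add: mult.assoc)
  have "k - int (Suc i) + 1 = k - int i"
    by simp
  then have "W (k - int (Suc i)) \<le> A * W (k - int i)"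
    using nb(2)[of "k - int (Suc i)"] by metis
  also have "\<dots> \<le> A * (A ^ i * W k)"
    using A Suc by (intro mult_left_mono) (auto simp: W_def)
  finally have "W (k - int (Suc i)) \<le> A ^ Suc i * W k"
    by (simp add: mult.assoc)
  with up show ?case
    by (simp add: W_def)
qed simp

lemma cdf_grid_increment_le:
  assumes "\<And>i. i < m \<Longrightarrow> digit_prod (weight \<delta>) n (k + int i) \<le> b"
  shows "cdf_grid \<delta> n (k + int m) - cdf_grid \<delta> n k \<le> real m * b"
  using assms
proof (induction m)
  case (Suc m)
  then have "cdf_grid \<delta> n (k + int m) - cdf_grid \<delta> n k \<le> real m * b"
    by simp
  moreover have "digit_prod (weight \<delta>) n (k + int m) \<le> b"
    using Suc.prems by simp
  ultimately show ?case
    using cdf_grid_Suc_diff[of \<delta> n "k + int m"] by (simp add: algebra_simps)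
qed simp

text \<open>
  For large \<open>r\<close> the cascade is within bounded error of Lebesgue measure. For small \<open>r\<close>, comparable
  to \<open>3 ^ (-n)\<close>, the smaller interval contains a cell at level \<open>n\<close>, the larger one is covered by
  boundedly many cells nearby, and neighbouring cells have comparable masses.
\<close>

lemma cdf_doubling:
  obtains C where "C \<ge> 1"
    "\<And>x r. r > 0 \<Longrightarrow> cdf \<delta> (x + 2 * r) - cdf \<delta> (x - 2 * r) \<le> C * (cdf \<delta> (x + r) - cdf \<delta> (x - r))"
proof -
  define A where "A = (1 - 2 * \<delta>) / \<delta>"
  have A: "1 \<le> A"
    using delta by (simp add: A_def field_simps)
  define C where "C = 13 * A ^ 9"
  have C: "13 \<le> C"
    using A by (simp add: C_def)
  have "cdf \<delta> (x + 2 * r) - cdf \<delta> (x - 2 * r) \<le> C * (cdf \<delta> (x + r) - cdf \<delta> (x - r))"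
    if r: "r > 0" for x r
  proof (cases "r \<ge> 2")
    case True
    have "cdf \<delta> (x + 2 * r) - cdf \<delta> (x - 2 * r) \<le> 5 * r"
      using abs_cdf_diff_le[of "x + 2 * r"] abs_cdf_diff_le[of "x - 2 * r"] True by (simp add: abs_le_iff)
    also have "\<dots> \<le> C * r"
      using C True by (intro mult_right_mono) auto
    also have "r \<le> cdf \<delta> (x + r) - cdf \<delta> (x - r)"
      using abs_cdf_diff_le[of "x + r"] abs_cdf_diff_le[of "x - r"] True by (simp add: abs_le_iff)
    then have "C * r \<le> C * (cdf \<delta> (x + r) - cdf \<delta> (x - r))"
      using C by (intro mult_left_mono) auto
    finally show ?thesis .
  next
    case False
    obtain n where n: "1 \<le> 3 ^ n * r" "3 ^ n * r \<le> 3"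
    proof -
      have "\<exists>n. 1 \<le> 3 ^ n * r"
      proof -
        obtain n where "1 / r < 3 ^ n"
          using real_arch_pow[of 3 "1 / r"] by auto
        then show ?thesis
          using r by (intro exI[of _ n]) (simp add: field_simps)
      qed
      define n where "n = (LEAST n. 1 \<le> 3 ^ n * r)"
      have "1 \<le> 3 ^ n * r"
        unfolding n_def by (rule LeastI_ex) fact
      moreover have "3 ^ n * r \<le> 3"
      proof (cases n)
        case 0
        then show ?thesis using False by simp
      next
        case (Suc m)
        then have "\<not> 1 \<le> 3 ^ m * r"
          unfolding n_def using not_less_Least[of m "\<lambda>n. 1 \<le> 3 ^ n * r"] by simp
        then show ?thesis
          using Suc by simp
      qed
      ultimately show thesis using that by blast
    qed
    define k where "k = \<lceil>3 ^ n * (x - r)\<rceil>"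
    have k: "3 ^ n * x - 3 ^ n * r \<le> of_int k" "of_int k < 3 ^ n * x - 3 ^ n * r + 1"
      by (auto simp: k_def algebra_simps; linarith)+
    define w where "w = digit_prod (weight \<delta>) n k"
    have w: "w > 0"
      unfolding w_def by (intro digit_prod_pos weight_pos)
    \<comment> \<open>Measured in cells, the larger interval reaches from at least \<open>k - 4\<close> to at most \<open>k + 9\<close>.\<close>
    have nb: "digit_prod (weight \<delta>) n (k - 4 + int i) \<le> A ^ 9 * w" if "i < 13" for i
    proof (cases "i \<ge> 4")
      case True
      have "digit_prod (weight \<delta>) n (k - 4 + int i) \<le> A ^ (i - 4) * w"
        using cell_weight_shift[of n k "i - 4"] True by (simp add: A_def w_def of_nat_diff algebra_simps)
      also have "\<dots> \<le> A ^ 9 * w"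
        using that A w by (intro mult_right_mono power_increasing) auto
      finally show ?thesis .
    next
      case False
      have "digit_prod (weight \<delta>) n (k - 4 + int i) \<le> A ^ (4 - i) * w"
        using cell_weight_shift[of n k "4 - i"] False by (simp add: A_def w_def of_nat_diff algebra_simps)
      also have "\<dots> \<le> A ^ 9 * w"
        using that A w by (intro mult_right_mono power_increasing) auto
      finally show ?thesis .
    qed
    have "cdf \<delta> (x + 2 * r) \<le> cdf_grid \<delta> n (k - 4 + int 13)"
      using k n by (intro cdf_le_grid) (simp add: field_simps)
    moreover have "cdf_grid \<delta> n (k - 4) \<le> cdf \<delta> (x - 2 * r)"
      using k n by (intro grid_le_cdf) (simp add: field_simps)
    ultimately have "cdf \<delta> (x + 2 * r) - cdf \<delta> (x - 2 * r) \<le> 13 * (A ^ 9 * w)"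
      using cdf_grid_increment_le[of 13 n "k - 4" "A ^ 9 * w", OF nb] by simp
    also have "\<dots> = C * w"
      by (simp add: C_def)
    also have "w \<le> cdf \<delta> (x + r) - cdf \<delta> (x - r)"
    proof -
      have "cdf_grid \<delta> n (k + 1) \<le> cdf \<delta> (x + r)"
        using k n by (intro grid_le_cdf) (simp add: field_simps)
      moreover have "cdf \<delta> (x - r) \<le> cdf_grid \<delta> n k"
        using k n by (intro cdf_le_grid) (simp add: field_simps)
      ultimately show ?thesis
        using cdf_grid_Suc_diff[of \<delta> n k] by (simp add: w_def)
    qed
    then have "C * w \<le> C * (cdf \<delta> (x + r) - cdf \<delta> (x - r))"
      using C by (intro mult_left_mono) auto
    finally show ?thesis .
  qed
  then show thesis
    using that[of C] C by auto
qed

end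

section \<open>Triadic cells and digits of a point\<close>

text \<open>
  Cells are open on the left and closed on the right, matching the intervals on which
  the measure of a distribution function is given. The cell number \<open>k\<close> contains its right end point
  \<open>(k + 1) / 3 ^ n\<close>, hence the ceiling minus one.
\<close>

definition cell_index :: "nat \<Rightarrow> real \<Rightarrow> int" where
  "cell_index n x = \<lceil>3 ^ n * x\<rceil> - 1"

lemma cell_index_Suc_div: "cell_index (Suc n) x div 3 = cell_index n x"
proof -
  define k where "k = cell_index n x"
  have "of_int k < 3 ^ n * x" "3 ^ n * x \<le> of_int k + 1"
    unfolding k_def cell_index_def by linarith+
  then have "3 * k \<le> cell_index (Suc n) x \<and> cell_index (Suc n) x \<le> 3 * k + 2"
    unfolding cell_index_def by (simp add: mult.assoc) linarith
  then show ?thesis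
    unfolding k_def[symmetric] by linarith
qed

lemma digit_prod_cell_index:
  "digit_prod f m (cell_index m x) = (\<Prod>j<m. f (cell_index (Suc j) x mod 3))"
  by (induction m) (simp_all add: cell_index_Suc_div)

lemma cell_index_eqI:
  assumes "cell_index 0 x = cell_index 0 y"
    and "\<And>j. j < m \<Longrightarrow> cell_index (Suc j) x mod 3 = cell_index (Suc j) y mod 3"
  shows "cell_index m x = cell_index m y"
  using assms(2)
proof (induction m)
  case 0
  show ?case by (fact assms(1))
next
  case (Suc m)
  then have "cell_index (Suc m) x div 3 = cell_index (Suc m) y div 3"
    by (simp add: cell_index_Suc_div)
  then show ?case
    using Suc.prems[of m] by (metis div_mult_mod_eq lessI)
qed

lemma abs_diff_le_of_cell_index_eq:
  assumes "cell_index m x = cell_index m y"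
  shows "\<bar>x - y\<bar> \<le> 1 / 3 ^ m"
proof -
  have "\<bar>3 ^ m * x - 3 ^ m * y\<bar> \<le> 1"
    using assms unfolding cell_index_def by linarith
  moreover have "\<bar>3 ^ m * x - 3 ^ m * y\<bar> = 3 ^ m * \<bar>x - y\<bar>"
    by (simp add: abs_mult flip: right_diff_distrib)
  ultimately show ?thesis
    by (simp add: field_simps)
qed

lemma sum_lessThan_times_3:
  "(\<Sum>k<3 * n. g k) = (\<Sum>k<n. g (3 * k) + g (3 * k + 1) + g (3 * k + 2))" for n :: nat
  by (induction n) (simp_all add: numeral_3_eq_3 add.assoc eval_nat_numeral)

lemma sum_digit_prod: "(\<Sum>k<3 ^ n. digit_prod f n (int k)) = (f 0 + f 1 + f 2) ^ n"
proof (induction n)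
  case (Suc n)
  have "(\<Sum>k<3 ^ Suc n. digit_prod f (Suc n) (int k)) =
    (\<Sum>k<3 ^ n. digit_prod f (Suc n) (int (3 * k)) + digit_prod f (Suc n) (int (3 * k + 1))
      + digit_prod f (Suc n) (int (3 * k + 2)))"
    by (simp only: power_Suc sum_lessThan_times_3)
  also have "\<dots> = (\<Sum>k<3 ^ n. digit_prod f n (int k) * (f 0 + f 1 + f 2))"
    by (rule sum.cong) (simp_all add: algebra_simps)
  also have "\<dots> = (f 0 + f 1 + f 2) ^ Suc n"
    by (simp add: Suc mult.commute flip: sum_distrib_right)
  finally show ?case .
qed simp

lemma digit_prod_mult: "digit_prod (\<lambda>i. f i * g i) n k = digit_prod f n k * digit_prod g n k"
  by (induction n arbitrary: k) simp_all

section \<open>Typical points of the cascade measure\<close>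

definition cascade :: "real \<Rightarrow> real measure" where
  "cascade \<delta> = interval_measure (cdf \<delta>)"

lemma sets_cascade [simp, measurable_cong]: "sets (cascade \<delta>) = sets borel"
  by (simp add: cascade_def)

context
  fixes \<delta> :: real
  assumes delta: "0 < \<delta>" "\<delta> < 1 / 3"
begin

lemma continuous_at_right_cdf: "continuous (at_right a) (cdf \<delta>)"
  using continuous_cdf[OF delta] by (rule continuous_at_imp_continuous_at_within)

lemma emeasure_cascade_Ioc:
  "a \<le> b \<Longrightarrow> emeasure (cascade \<delta>) {a<..b} = ennreal (cdf \<delta> b - cdf \<delta> a)"
  unfolding cascade_def
  by (rule emeasure_interval_measure_Ioc) (use cdf_mono[OF delta] continuous_at_right_cdf in auto)

lemma sigma_finite_cascade: "sigma_finite_measure (cascade \<delta>)"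
  unfolding cascade_def
  by (rule sigma_finite_interval_measure) (use cdf_mono[OF delta] continuous_at_right_cdf in auto)

lemma emeasure_cascade_cell:
  "emeasure (cascade \<delta>) {of_int k / 3 ^ n<..of_int (k + 1) / 3 ^ n} = ennreal (digit_prod (weight \<delta>) n k)"
proof -
  have "emeasure (cascade \<delta>) {of_int k / 3 ^ n<..of_int (k + 1) / 3 ^ n} =
    ennreal (cdf \<delta> (of_int (k + 1) / 3 ^ n) - cdf \<delta> (of_int k / 3 ^ n))"
    by (rule emeasure_cascade_Ioc) (simp add: divide_right_mono)
  then show ?thesis
    by (simp only: cdf_grid_point[OF delta] cdf_grid_Suc_diff)
qed

text \<open>
  The mean over the cascade of the product of \<open>f\<close> over the first \<open>m\<close> digits is the \<open>m\<close>-th power of the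
  mean of \<open>f\<close> over a single digit. By Markov's inequality the product exceeds \<open>C * r ^ m\<close> with probability at
  most \<open>(s / r) ^ m / C\<close>, where \<open>s < r\<close> is the single-digit mean. The sum of these bounds over \<open>m\<close> is below 1
  for large \<open>C\<close>.
\<close>

lemma digit_prod_bounded_on_positive_set:
  fixes f :: "int \<Rightarrow> real"
  assumes f: "\<And>i. 0 < f i" and mean: "\<delta> * f 0 + (1 - 2 * \<delta>) * f 1 + \<delta> * f 2 < r"
  obtains A C where "A \<in> sets borel" "A \<subseteq> {0<..1}" "0 < emeasure (cascade \<delta>) A" "0 < C"
    "\<And>x m. x \<in> A \<Longrightarrow> digit_prod f m (cell_index m x) \<le> C * r ^ m"
proof -
  define s where "s = \<delta> * f 0 + (1 - 2 * \<delta>) * f 1 + \<delta> * f 2"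
  have s: "0 < s" "s < r"
    using f[of 0] f[of 1] f[of 2] delta mean unfolding s_def by (auto intro!: add_pos_pos)
  \<comment> \<open>With this choice the geometric series of the exceptional probabilities sums to one half.\<close>
  define C where "C = 2 / (1 - s / r)"
  have C: "0 < C" using s by (simp add: C_def)
  define cell where "cell m k = {of_int k / 3 ^ m<..of_int (k + 1) / (3 ^ m :: real)}" for m k
  define bad where "bad m = {k\<in>{..<3 ^ m}. C * r ^ m < digit_prod f m (int k)}" for m :: nat
  define Bad where "Bad m = (\<Union>k\<in>bad m. cell m (int k))" for m
  let ?w = "digit_prod (weight \<delta>)"
  have wpos: "0 \<le> ?w m k" for m k
    using digit_prod_pos[of "weight \<delta>", OF weight_pos[OF delta]] by (simp add: less_imp_le)
  have fpos: "0 \<le> digit_prod f m k" for m k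
    using digit_prod_pos[of f, OF f] by (simp add: less_imp_le)
  have meas: "cell m k \<in> sets borel" "Bad m \<in> sets borel" for m k
    by (auto simp: cell_def Bad_def bad_def)
  have "emeasure (cascade \<delta>) (Bad m) \<le> ennreal ((s / r) ^ m / C)" for m
  proof -
    have "emeasure (cascade \<delta>) (Bad m) \<le> (\<Sum>k\<in>bad m. emeasure (cascade \<delta>) (cell m (int k)))"
      unfolding Bad_def using meas by (intro emeasure_subadditive_finite) (auto simp: bad_def)
    also have "\<dots> = ennreal (\<Sum>k\<in>bad m. ?w m (int k))"
      unfolding cell_def emeasure_cascade_cell using wpos by (intro sum_ennreal) auto
    also have "\<dots> \<le> ennreal ((s / r) ^ m / C)"
    proof (rule ennreal_leI)
      \<comment> \<open>Markov: on the bad cells the quotient inserted here is at least 1.\<close>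
      have "(\<Sum>k\<in>bad m. ?w m (int k)) \<le> (\<Sum>k\<in>bad m. ?w m (int k) * (digit_prod f m (int k) / (C * r ^ m)))"
      proof (rule sum_mono)
        fix k assume "k \<in> bad m"
        then have "1 \<le> digit_prod f m (int k) / (C * r ^ m)"
          using C s by (simp add: bad_def)
        then show "?w m (int k) \<le> ?w m (int k) * (digit_prod f m (int k) / (C * r ^ m))"
          using mult_left_mono[OF _ wpos] by fastforce
      qed
      also have "\<dots> \<le> (\<Sum>k<3 ^ m. ?w m (int k) * (digit_prod f m (int k) / (C * r ^ m)))"
        using C s wpos fpos by (intro sum_mono2) (auto simp: bad_def)
      also have "\<dots> = (\<Sum>k<3 ^ m. digit_prod (\<lambda>i. weight \<delta> i * f i) m (int k)) / (C * r ^ m)"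
        by (simp add: digit_prod_mult sum_divide_distrib)
      also have "\<dots> = s ^ m / (C * r ^ m)"
        unfolding sum_digit_prod by (simp add: s_def weight_def)
      also have "\<dots> = (s / r) ^ m / C"
        by (simp add: power_divide)
      finally show "(\<Sum>k\<in>bad m. ?w m (int k)) \<le> (s / r) ^ m / C" .
    qed
    finally show ?thesis .
  qed
  then have "(\<Sum>m. emeasure (cascade \<delta>) (Bad m)) \<le> (\<Sum>m. ennreal ((s / r) ^ m / C))"
    by (intro suminf_le) auto
  also have "\<dots> = ennreal (\<Sum>m. (s / r) ^ m / C)"
    using s C by (intro suminf_ennreal2 summable_divide summable_geometric) auto
  also have "(\<Sum>m. (s / r) ^ m / C) = 1 / 2"
    using s C by (subst suminf_divide) (auto simp: suminf_geometric summable_geometric C_def)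
  finally have Bad_half: "emeasure (cascade \<delta>) (\<Union>m. Bad m) \<le> ennreal (1 / 2)"
    using emeasure_subadditive_countably[of Bad "cascade \<delta>"] meas by (auto intro: order_trans)
  define A where "A = {0<..1} - (\<Union>m. Bad m)"
  show thesis
  proof
    show A: "A \<in> sets borel"
      unfolding A_def using meas by auto
    show "A \<subseteq> {0<..1}" by (auto simp: A_def)
    show "0 < emeasure (cascade \<delta>) A"
    proof (rule ccontr)
      assume "\<not> 0 < emeasure (cascade \<delta>) A"
      then have "emeasure (cascade \<delta>) A = 0" by simp
      have "1 = emeasure (cascade \<delta>) {0<..1}"
        using emeasure_cascade_cell[of 0 0] by simp
      also have "\<dots> \<le> emeasure (cascade \<delta>) (A \<union> (\<Union>m. Bad m))"
        using A meas by (intro emeasure_mono) (auto simp: A_def)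
      also have "\<dots> \<le> emeasure (cascade \<delta>) A + emeasure (cascade \<delta>) (\<Union>m. Bad m)"
        using A meas by (intro emeasure_subadditive) auto
      also have "\<dots> \<le> ennreal (1 / 2)"
        using \<open>emeasure (cascade \<delta>) A = 0\<close> Bad_half by simp
      finally have "ennreal 1 \<le> ennreal (1 / 2)" by simp
      then show False by (subst (asm) ennreal_le_iff) auto
    qed
    fix x m assume x: "x \<in> A"
    define k where "k = cell_index m x"
    have k: "of_int k < 3 ^ m * x" "3 ^ m * x \<le> of_int k + 1"
      unfolding k_def cell_index_def by linarith+
    have x01: "0 < x" "x \<le> 1" using x by (auto simp: A_def)
    have "0 < 3 ^ m * x" "3 ^ m * x \<le> 3 ^ m"
      using x01 by auto
    then have "real_of_int (-1) < of_int k" "real_of_int k < 3 ^ m"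
      using k by linarith+
    then have "real_of_int (-1) < of_int k" "real_of_int k < of_int (3 ^ m)"
      by simp_all
    then have k0: "0 \<le> k" "k < 3 ^ m"
      unfolding of_int_less_iff by simp_all
    have "x \<in> cell m (int (nat k))"
      using k k0 by (simp add: cell_def field_simps)
    then have "nat k \<notin> bad m"
      using x unfolding A_def Bad_def by blast
    moreover have "nat k < 3 ^ m"
      using k0 by (simp add: nat_less_iff)
    ultimately show "digit_prod f m (cell_index m x) \<le> C * r ^ m"
      using k0 by (simp add: bad_def k_def)
  qed (fact C)
qed

end

section \<open>Products of the cascade measure\<close>

definition vec_product_measure :: "real measure \<Rightarrow> (real ^ 'n) measure" where
  "vec_product_measure M = distr (\<Pi>\<^sub>M i\<in>UNIV. M) borel (\<lambda>f. \<chi> i. f i)"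

lemma emeasure_vec_product_measure:
  fixes A :: "'n::finite \<Rightarrow> real set"
  assumes "sigma_finite_measure M" and M: "sets M = sets borel" and A: "\<And>i. A i \<in> sets borel"
  shows "emeasure (vec_product_measure M) {x. \<forall>i. x $ i \<in> A i} = (\<Prod>i\<in>UNIV. emeasure M (A i))"
proof -
  interpret product_sigma_finite "\<lambda>_::'n. M"
    using assms(1) by (simp add: product_sigma_finite_def)
  have [measurable_cong]: "sets M = sets borel" by fact
  have vec: "(\<lambda>f. \<chi> i. f i) \<in> (\<Pi>\<^sub>M i\<in>(UNIV::'n set). M) \<rightarrow>\<^sub>M (borel :: (real ^ 'n) measure)"
  proof (rule borel_measurable_euclidean_space[THEN iffD2], rule ballI)
    fix b :: "real ^ 'n" assume "b \<in> Basis"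
    then obtain i where "b = axis i 1"
      by (auto simp: Basis_vec_def)
    then show "(\<lambda>f. (\<chi> i. f i) \<bullet> b) \<in> borel_measurable (\<Pi>\<^sub>M i\<in>(UNIV::'n set). M)"
      by (simp add: inner_axis)
  qed
  have "{x :: real ^ 'n. \<forall>i. x $ i \<in> A i} = (\<Inter>i\<in>UNIV. (\<lambda>x. x $ i) -` A i \<inter> space borel)"
    by auto
  also have "\<dots> \<in> sets borel"
    using A by (intro sets.finite_INT measurable_sets[of _ borel borel]) (auto intro!: borel_measurable_continuous_onI continuous_intros)
  finally have S: "{x :: real ^ 'n. \<forall>i. x $ i \<in> A i} \<in> sets borel" .
  have "emeasure (vec_product_measure M) {x. \<forall>i. x $ i \<in> A i} =
    emeasure (\<Pi>\<^sub>M i\<in>(UNIV::'n set). M) ((\<lambda>f. \<chi> i. f i) -` {x. \<forall>i. x $ i \<in> A i} \<inter> space (\<Pi>\<^sub>M i\<in>(UNIV::'n set). M))"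
    unfolding vec_product_measure_def by (rule emeasure_distr[OF vec S])
  also have "(\<lambda>f. \<chi> i. f i) -` {x. \<forall>i. x $ i \<in> A i} \<inter> space (\<Pi>\<^sub>M i\<in>(UNIV::'n set). M) = Pi\<^sub>E UNIV A"
    using sets_eq_imp_space_eq[OF M] by (auto simp: space_PiM PiE_def Pi_def)
  also have "emeasure (\<Pi>\<^sub>M i\<in>(UNIV::'n set). M) (Pi\<^sub>E UNIV A) = (\<Prod>i\<in>UNIV. emeasure M (A i))"
    using A M by (intro emeasure_PiM) auto
  finally show ?thesis .
qed

lemma cube_subset_ball:
  fixes x :: "real ^ 'n"
  assumes "0 < r"
  shows "{y. \<forall>i. y $ i \<in> {x $ i - r / (2 * real CARD('n))<..x $ i + r / (2 * real CARD('n))}} \<subseteq> ball x r"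
proof
  fix y assume y: "y \<in> {y. \<forall>i. y $ i \<in> {x $ i - r / (2 * real CARD('n))<..x $ i + r / (2 * real CARD('n))}}"
  have "\<bar>(x - y) $ i\<bar> \<le> r / (2 * real CARD('n))" for i
    using y by (simp add: abs_le_iff) (metis add.commute diff_le_eq le_diff_eq less_imp_le)
  then have "(\<Sum>i\<in>UNIV. \<bar>(x - y) $ i\<bar>) \<le> real CARD('n) * (r / (2 * real CARD('n)))"
    by (intro sum_bounded_above) auto
  also have "\<dots> = r / 2" by simp
  finally show "y \<in> ball x r"
    using norm_le_l1_cart[of "x - y"] assms by (simp add: dist_norm)
qed

lemma ball_subset_cube:
  fixes x :: "real ^ 'n"
  shows "ball x r \<subseteq> {y. \<forall>i. y $ i \<in> {x $ i - r<..x $ i + r}}"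
proof
  fix y assume "y \<in> ball x r"
  then have "\<bar>x $ i - y $ i\<bar> < r" for i
    using dist_vec_nth_le[of x i y] by (simp add: dist_real_def)
  then show "y \<in> {y. \<forall>i. y $ i \<in> {x $ i - r<..x $ i + r}}"
    by (auto simp: abs_less_iff) (smt (verit, best))+
qed

text \<open>
  A ball lies between two concentric cubes whose side lengths have a ratio depending on the dimension only, and
  the measure of a cube is a product of increments of the distribution function. So a fixed number of doublings
  in each coordinate suffices.
\<close>

lemma doubling_measure_cascade:
  assumes delta: "0 < \<delta>" "\<delta> < 1 / 3"
  shows "doubling_measure (vec_product_measure (cascade \<delta>) :: (real ^ 'n) measure)"
proof -
  let ?\<nu> = "vec_product_measure (cascade \<delta>) :: (real ^ 'n) measure"
  have sets: "sets ?\<nu> = sets borel" by (simp add: vec_product_measure_def)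
  have box: "emeasure ?\<nu> {y. \<forall>i. y $ i \<in> {x $ i - r<..x $ i + r}} =
    ennreal (\<Prod>i\<in>UNIV. cdf \<delta> (x $ i + r) - cdf \<delta> (x $ i - r))" if "0 < r" for x r
  proof -
    have "emeasure ?\<nu> {y. \<forall>i. y $ i \<in> {x $ i - r<..x $ i + r}} =
      (\<Prod>i\<in>UNIV. ennreal (cdf \<delta> (x $ i + r) - cdf \<delta> (x $ i - r)))"
      using that by (subst emeasure_vec_product_measure[OF sigma_finite_cascade[OF delta]])
        (simp_all add: emeasure_cascade_Ioc[OF delta])
    then show ?thesis
      using that cdf_mono[OF delta] by (simp add: prod_ennreal)
  qed
  have cube_sets: "{y :: real ^ 'n. \<forall>i. y $ i \<in> {x $ i - r<..x $ i + r}} \<in> sets borel" for x r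
  proof -
    have "{y :: real ^ 'n. \<forall>i. y $ i \<in> {x $ i - r<..x $ i + r}} =
      (\<Inter>i. {y. x $ i - r < y $ i} \<inter> {y. y $ i \<le> x $ i + r})"
      by auto
    also have "\<dots> \<in> sets borel"
      by (intro sets.finite_INT sets.Int borel_open borel_closed open_Collect_less closed_Collect_le
          continuous_intros) auto
    finally show ?thesis .
  qed
  obtain C where C: "1 \<le> C"
    "\<And>x r. r > 0 \<Longrightarrow> cdf \<delta> (x + 2 * r) - cdf \<delta> (x - 2 * r) \<le> C * (cdf \<delta> (x + r) - cdf \<delta> (x - r))"
    using cdf_doubling[OF delta] by blast
  have iterate: "cdf \<delta> (x + 2 ^ k * r) - cdf \<delta> (x - 2 ^ k * r) \<le> C ^ k * (cdf \<delta> (x + r) - cdf \<delta> (x - r))"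
    if "0 < r" for x r k
  proof (induction k)
    case (Suc k)
    have "cdf \<delta> (x + 2 ^ Suc k * r) - cdf \<delta> (x - 2 ^ Suc k * r) \<le>
      C * (cdf \<delta> (x + 2 ^ k * r) - cdf \<delta> (x - 2 ^ k * r))"
      using C(2)[of "2 ^ k * r" x] that by (simp add: mult.assoc)
    also have "\<dots> \<le> C * (C ^ k * (cdf \<delta> (x + r) - cdf \<delta> (x - r)))"
      using C(1) Suc by (intro mult_left_mono) auto
    finally show ?case by (simp add: mult.assoc)
  qed simp
  let ?d = "CARD('n)"
  obtain k where k: "4 * real ?d < 2 ^ k"
    using real_arch_pow[of 2] by auto
  show ?thesis
    unfolding doubling_measure_def
  proof (intro conjI allI impI exI)
    show "sets ?\<nu> = sets borel" by fact
  next
    fix x :: "real ^ 'n" and r :: real assume r: "0 < r"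
    have "emeasure ?\<nu> (ball x r) \<le> emeasure ?\<nu> {y. \<forall>i. y $ i \<in> {x $ i - r<..x $ i + r}}"
      using cube_sets by (intro emeasure_mono ball_subset_cube) (auto simp: sets)
    then show "emeasure ?\<nu> (ball x r) < \<infinity>"
      unfolding box[OF r] by (simp add: le_less_trans)
  next
    fix x :: "real ^ 'n" and r :: real assume r: "0 < r"
    define t where "t = r / (2 * real ?d)"
    have t: "0 < t" using r by (simp add: t_def)
    have "2 * r \<le> 2 ^ k * t"
      using k r by (simp add: t_def field_simps)
    then have cdf_le: "cdf \<delta> (x $ i + 2 * r) - cdf \<delta> (x $ i - 2 * r) \<le> C ^ k * (cdf \<delta> (x $ i + t) - cdf \<delta> (x $ i - t))" for i
      using iterate[OF t, of "x $ i" k] cdf_mono[OF delta, of "x $ i + 2 * r" "x $ i + 2 ^ k * t"]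
        cdf_mono[OF delta, of "x $ i - 2 ^ k * t" "x $ i - 2 * r"] by linarith
    have "emeasure ?\<nu> (ball x (2 * r)) \<le> emeasure ?\<nu> {y. \<forall>i. y $ i \<in> {x $ i - 2 * r<..x $ i + 2 * r}}"
      using cube_sets by (intro emeasure_mono ball_subset_cube) (auto simp: sets)
    also have "\<dots> = ennreal (\<Prod>i\<in>UNIV. cdf \<delta> (x $ i + 2 * r) - cdf \<delta> (x $ i - 2 * r))"
      using r by (intro box) simp
    also have "\<dots> \<le> ennreal (\<Prod>i\<in>UNIV. C ^ k * (cdf \<delta> (x $ i + t) - cdf \<delta> (x $ i - t)))"
      using r cdf_mono[OF delta] cdf_le by (intro ennreal_leI prod_mono) auto
    also have "\<dots> = ennreal ((C ^ k) ^ ?d) * ennreal (\<Prod>i\<in>UNIV. cdf \<delta> (x $ i + t) - cdf \<delta> (x $ i - t))"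
      using C(1) t cdf_mono[OF delta] by (simp add: prod.distrib ennreal_mult prod_nonneg)
    also have "\<dots> = ennreal ((C ^ k) ^ ?d) * emeasure ?\<nu> {y. \<forall>i. y $ i \<in> {x $ i - t<..x $ i + t}}"
      by (simp only: box[OF t])
    also have "\<dots> \<le> ennreal ((C ^ k) ^ ?d) * emeasure ?\<nu> (ball x r)"
      using cube_subset_ball[OF r, of x] by (intro mult_left_mono emeasure_mono) (auto simp: t_def sets)
    finally show "emeasure ?\<nu> (ball x (2 * r)) \<le> ennreal ((C ^ k) ^ ?d) * emeasure ?\<nu> (ball x r)" .
  qed
qed

section \<open>Rectifiable curves through sets with an expanding coordinate\<close>

text \<open>
  McShane's extension: the greatest of the \<open>L\<close>-Lipschitz functions lying below every cone
  \<open>f s + L * dist s t\<close> with apex over \<open>S\<close>.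
\<close>

lemma lipschitz_extension_real:
  fixes f :: "'a::metric_space \<Rightarrow> real"
  assumes "L-lipschitz_on S f"
  obtains g where "L-lipschitz_on UNIV g" "\<And>x. x \<in> S \<Longrightarrow> g x = f x"
proof (cases "S = {}")
  case True
  have "L-lipschitz_on UNIV (\<lambda>_::'a. 0::real)"
    using assms by (auto simp: lipschitz_on_def)
  then show ?thesis using True that by blast
next
  case False
  have L: "0 \<le> L" using assms by (rule lipschitz_on_nonneg)
  have Lip: "\<bar>f x - f y\<bar> \<le> L * dist x y" if "x \<in> S" "y \<in> S" for x y
    using lipschitz_onD[OF assms that] by (simp add: dist_real_def)
  define g where "g t = (INF s\<in>S. f s + L * dist s t)" for t
  have bdd: "bdd_below ((\<lambda>s. f s + L * dist s t) ` S)" for t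
  proof -
    obtain a where a: "a \<in> S" using False by blast
    have "f a - L * dist a t \<le> f s + L * dist s t" if "s \<in> S" for s
    proof -
      have "L * dist a s \<le> L * (dist a t + dist s t)"
        using L by (intro mult_left_mono) (auto intro: dist_triangle2)
      then show ?thesis using Lip[OF a that] by (simp add: algebra_simps abs_le_iff)
    qed
    then show ?thesis by (intro bdd_belowI2)
  qed
  have one: "g t \<le> g u + L * dist t u" for t u
  proof -
    have "g t - L * dist t u \<le> g u"
      unfolding g_def[of u]
    proof (rule cINF_greatest[OF False])
      fix s assume "s \<in> S"
      then have "g t \<le> f s + L * dist s t"
        unfolding g_def by (rule cINF_lower[OF bdd])
      also have "L * dist s t \<le> L * (dist s u + dist t u)"
        using L by (intro mult_left_mono) (auto intro: dist_triangle2)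
      finally show "g t - L * dist t u \<le> f s + L * dist s u"
        by (simp add: algebra_simps)
    qed
    then show ?thesis by simp
  qed
  show thesis
  proof
    show "L-lipschitz_on UNIV g"
    proof (rule lipschitz_onI)
      fix t u show "dist (g t) (g u) \<le> L * dist t u"
        using one[of t u] one[of u t] by (simp add: dist_real_def dist_commute abs_le_iff)
    qed (fact L)
    fix x assume x: "x \<in> S"
    show "g x = f x"
    proof (rule antisym)
      show "g x \<le> f x"
        unfolding g_def using cINF_lower[OF bdd x, of x] by simp
      show "f x \<le> g x"
        unfolding g_def
      proof (rule cINF_greatest[OF False])
        fix s assume "s \<in> S"
        then show "f x \<le> f s + L * dist s x"
          using Lip[OF x, of s] by (simp add: abs_le_iff dist_commute)
      qed
    qed
  qed
qed

lemma dist_vec_le_sum: "dist x y \<le> (\<Sum>i\<in>UNIV. dist (x $ i) (y $ i))"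
  for x y :: "real ^ 'n"
  unfolding dist_norm by (rule order_trans[OF norm_le_l1_cart]) simp

lemma lipschitz_extension_vec:
  fixes f :: "'a::metric_space \<Rightarrow> real ^ 'n"
  assumes "L-lipschitz_on S f"
  obtains g where "(real CARD('n) * L)-lipschitz_on UNIV g" "\<And>x. x \<in> S \<Longrightarrow> g x = f x"
proof -
  have "\<exists>g. L-lipschitz_on UNIV g \<and> (\<forall>x\<in>S. g x = f x $ i)" for i
  proof (rule lipschitz_extension_real[of L S "\<lambda>x. f x $ i"])
    show "L-lipschitz_on S (\<lambda>x. f x $ i)"
      using assms dist_vec_nth_le[of "f _" i "f _"] unfolding lipschitz_on_def
      by (meson order_trans)
  qed auto
  then obtain g where g: "\<And>i. L-lipschitz_on UNIV (g i)" "\<And>i x. x \<in> S \<Longrightarrow> g i x = f x $ i"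
    by metis
  show thesis
  proof
    show "(real CARD('n) * L)-lipschitz_on UNIV (\<lambda>x. \<chi> i. g i x)"
    proof (rule lipschitz_onI)
      fix x y
      have "dist (\<chi> i. g i x) (\<chi> i. g i y) \<le> (\<Sum>i\<in>UNIV. dist (g i x) (g i y))"
        using dist_vec_le_sum[of "\<chi> i. g i x" "\<chi> i. g i y"] by simp
      also have "\<dots> \<le> real CARD('n) * (L * dist x y)"
        using lipschitz_onD[OF g(1)] by (intro sum_bounded_above) auto
      finally show "dist (\<chi> i. g i x) (\<chi> i. g i y) \<le> real CARD('n) * L * dist x y"
        by (simp add: mult.assoc)
    qed (use lipschitz_on_nonneg[OF assms] in simp)
  qed (simp add: g(2) vec_eq_iff)
qed

lemma rectifiable_curve_lipschitz:
  fixes \<gamma> :: "real \<Rightarrow> 'a::metric_space"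
  assumes "L-lipschitz_on UNIV \<gamma>"
  shows "rectifiable_curve \<gamma>"
proof -
  have L: "0 \<le> L" using assms by (rule lipschitz_on_nonneg)
  have "path \<gamma>"
    unfolding path_def by (rule lipschitz_on_continuous_on[OF lipschitz_on_subset[OF assms]]) simp
  moreover have "curve_length \<gamma> \<le> ennreal L"
    unfolding curve_length_def
  proof (rule SUP_least, clarify)
    fix n and t :: "nat \<Rightarrow> real"
    assume t: "mono_on {0..n} t" "t ` {0..n} \<subseteq> {0..1}"
    have step: "dist (\<gamma> (t j)) (\<gamma> (t (j - 1))) \<le> L * (t j - t (j - 1))" if "j \<in> {1..n}" for j
    proof -
      have "t (j - 1) \<le> t j"
        using t(1) that by (intro mono_onD[OF t(1)]) auto
      then show ?thesis
        using lipschitz_onD[OF assms, of "t j" "t (j - 1)"] by (simp add: dist_real_def)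
    qed
    have "(\<Sum>j=1..n. ennreal (dist (\<gamma> (t j)) (\<gamma> (t (j - 1))))) =
      ennreal (\<Sum>j=1..n. dist (\<gamma> (t j)) (\<gamma> (t (j - 1))))"
      by (rule sum_ennreal) auto
    also have "\<dots> \<le> ennreal (\<Sum>j=1..n. L * (t j - t (j - 1)))"
      by (intro ennreal_leI sum_mono step)
    also have "(\<Sum>j=1..n. L * (t j - t (j - 1))) = L * (t n - t 0)"
      by (induction n) (simp_all add: algebra_simps)
    also have "\<dots> \<le> L * 1"
      proof (rule mult_left_mono[OF _ L])
      have "t n \<in> {0..1}" "t 0 \<in> {0..1}"
        using t(2) by (simp_all add: image_subset_iff)
      then show "t n - t 0 \<le> 1"
        by simp
    qed
    finally show "(\<Sum>j=1..n. ennreal (dist (\<gamma> (t j)) (\<gamma> (t (j - 1))))) \<le> ennreal L"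
      by (simp add: ennreal_leI)
  qed
  ultimately show ?thesis
    unfolding rectifiable_curve_def by (simp add: le_less_trans)
qed

text \<open>
  A function that does not contract distances by more than a constant factor is injective with a Lipschitz
  inverse. The inverse lives on an arbitrary subset of the unit interval, so extending it to the whole
  interval yields the curve.
\<close>

lemma rectifiable_curve_covers:
  fixes K :: "(real ^ 'n) set"
  assumes T: "\<And>x. x \<in> K \<Longrightarrow> T x \<in> {0..1}" and "0 \<le> L"
    and expand: "\<And>x y. x \<in> K \<Longrightarrow> y \<in> K \<Longrightarrow> dist x y \<le> L * \<bar>T x - T y\<bar>"
  obtains \<gamma> where "rectifiable_curve \<gamma>" "K \<subseteq> path_image \<gamma>"
proof -
  have "inj_on T K"
  proof (rule inj_onI)
    fix x y assume "x \<in> K" "y \<in> K" "T x = T y"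
    then show "x = y" using expand[of x y] by simp
  qed
  then have inv: "the_inv_into K T (T x) = x" if "x \<in> K" for x
    using that by (rule the_inv_into_f_f)
  have "L-lipschitz_on (T ` K) (the_inv_into K T)"
  proof (rule lipschitz_onI)
    fix s t assume "s \<in> T ` K" "t \<in> T ` K"
    then show "dist (the_inv_into K T s) (the_inv_into K T t) \<le> L * dist s t"
      using expand by (auto simp: inv dist_real_def)
  qed fact
  then obtain \<gamma> where \<gamma>: "(real CARD('n) * L)-lipschitz_on UNIV \<gamma>"
    "\<And>t. t \<in> T ` K \<Longrightarrow> \<gamma> t = the_inv_into K T t"
    using lipschitz_extension_vec by blast
  show thesis
  proof
    show "rectifiable_curve \<gamma>" using \<gamma>(1) by (rule rectifiable_curve_lipschitz)
    show "K \<subseteq> path_image \<gamma>"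
    proof
      fix x assume x: "x \<in> K"
      then have "\<gamma> (T x) = x" using \<gamma>(2)[of "T x"] inv by simp
      then show "x \<in> path_image \<gamma>"
        unfolding path_image_def using T[OF x] by (metis image_eqI)
    qed
  qed
qed

text \<open>
  Nested interval coding: inside the current interval, the letter \<open>a\<close> selects the subinterval that starts at
  relative position \<open>pos a\<close> and has relative length \<open>q a\<close>. Two sequences which first differ after \<open>m\<close> letters
  end up in subintervals of the same interval, of length at least \<open>c / 3 ^ m\<close>, with a gap of relative
  size at least \<open>\<eta>\<close> between them.
\<close>

lemma digit_code_separates:
  fixes dg :: "'a::metric_space \<Rightarrow> nat \<Rightarrow> 'l" and pos q :: "'l \<Rightarrow> real"
  assumes q: "\<And>a. a \<in> D \<Longrightarrow> 0 < q a \<and> q a \<le> 1 / 2"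
    and pos: "\<And>a. a \<in> D \<Longrightarrow> 0 \<le> pos a \<and> pos a + q a \<le> 1"
    and gap: "\<And>a b. a \<in> D \<Longrightarrow> b \<in> D \<Longrightarrow> a \<noteq> b \<Longrightarrow> pos a + q a + \<eta> \<le> pos b \<or> pos b + q b + \<eta> \<le> pos a"
    and "0 < \<eta>" "0 < c" "0 \<le> M"
    and dg: "\<And>x j. x \<in> K \<Longrightarrow> dg x j \<in> D"
    and near: "\<And>x y m. x \<in> K \<Longrightarrow> y \<in> K \<Longrightarrow> (\<forall>j<m. dg x j = dg y j) \<Longrightarrow> dist x y \<le> M / 3 ^ m"
    and low: "\<And>x m. x \<in> K \<Longrightarrow> c / 3 ^ m \<le> (\<Prod>j<m. q (dg x j))"
  obtains T where "\<And>x. x \<in> K \<Longrightarrow> T x \<in> {0..1}"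
    "\<And>x y. x \<in> K \<Longrightarrow> y \<in> K \<Longrightarrow> dist x y \<le> M / (c * \<eta>) * \<bar>T x - T y\<bar>"
proof -
  \<comment> \<open>The interval selected by the first \<open>m\<close> letters of \<open>x\<close> starts at \<open>P x m\<close> and has length \<open>Q x m\<close>.\<close>
  define Q where "Q x m = (\<Prod>j<m. q (dg x j))" for x m
  define P where "P x m = (\<Sum>j<m. Q x j * pos (dg x j))" for x m
  define T where "T x = lim (P x)" for x
  have Q_Suc: "Q x (Suc m) = Q x m * q (dg x m)" for x m by (simp add: Q_def)
  have P_Suc: "P x (Suc m) = P x m + Q x m * pos (dg x m)" for x m by (simp add: P_def)
  have Q0: "0 \<le> Q x m" if "x \<in> K" for x m
    unfolding Q_def by (rule prod_nonneg) (use q[OF dg[OF that]] in \<open>simp add: less_imp_le\<close>)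
  have incP: "P x m \<le> P x (Suc m)" if "x \<in> K" for x m
    using Q0[OF that, of m] pos[OF dg[OF that]] by (simp add: P_Suc)
  have decPQ: "P x (Suc m) + Q x (Suc m) \<le> P x m + Q x m" if "x \<in> K" for x m
  proof -
    have "Q x m * (pos (dg x m) + q (dg x m)) \<le> Q x m * 1"
      using Q0[OF that, of m] pos[OF dg[OF that]] by (intro mult_left_mono) auto
    then show ?thesis by (simp add: P_Suc Q_Suc algebra_simps)
  qed
  have inc: "incseq (P x)" and dec: "decseq (\<lambda>m. P x m + Q x m)" if "x \<in> K" for x
    using incP[OF that] decPQ[OF that] by (auto intro: incseq_SucI decseq_SucI)
  \<comment> \<open>Left end points increase and right end points decrease, so each left end point is below each right one.\<close>
  have bound: "P x n \<le> P x m + Q x m" if "x \<in> K" for x n m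
  proof -
    have "P x n \<le> P x (max n m) + Q x (max n m)"
      using incseqD[OF inc[OF that], of n "max n m"] Q0[OF that, of "max n m"] by simp
    also have "\<dots> \<le> P x m + Q x m"
      using decseqD[OF dec[OF that], of m "max n m"] by simp
    finally show ?thesis .
  qed
  have lim: "P x \<longlonglongrightarrow> T x" if "x \<in> K" for x
    using incseq_convergent[OF inc[OF that], of "P x 0 + Q x 0"] bound[OF that, of _ 0]
    unfolding T_def by (metis limI)
  have T: "P x m \<le> T x" "T x \<le> P x m + Q x m" if "x \<in> K" for x m
    using incseq_le[OF inc[OF that] lim[OF that]] LIMSEQ_le_const2[OF lim[OF that]] bound[OF that]
    by blast+
  show thesis
  proof
    fix x assume x: "x \<in> K"
    show "T x \<in> {0..1}"
      using T[OF x, of 0] by (simp add: P_def Q_def)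
  next
    fix x y assume x: "x \<in> K" and y: "y \<in> K"
    show "dist x y \<le> M / (c * \<eta>) * \<bar>T x - T y\<bar>"
    proof (cases "\<forall>j. dg x j = dg y j")
      case True
      have "(\<lambda>m. M * (1 / 3) ^ m) \<longlonglongrightarrow> M * 0"
        by (intro tendsto_mult tendsto_const LIMSEQ_power_zero) auto
      moreover have "dist x y \<le> M * (1 / 3) ^ m" for m
        using near[OF x y, of m] True by (simp add: power_divide)
      ultimately have "dist x y \<le> 0"
        using LIMSEQ_le_const[of "\<lambda>m. M * (1 / 3) ^ m" "M * 0" "dist x y"] by auto
      also have "0 \<le> M / (c * \<eta>) * \<bar>T x - T y\<bar>"
        using assms(4-6) by simp
      finally show ?thesis .
    next
      case False
      define m where "m = (LEAST j. dg x j \<noteq> dg y j)"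
      have ne: "dg x m \<noteq> dg y m"
        using LeastI_ex[of "\<lambda>j. dg x j \<noteq> dg y j"] False by (simp add: m_def)
      have eq: "\<forall>j<m. dg x j = dg y j"
      proof (intro allI impI)
        fix j assume "j < m"
        then have "\<not> dg x j \<noteq> dg y j"
          unfolding m_def by (rule not_less_Least)
        then show "dg x j = dg y j" by simp
      qed
      have QQ: "Q y i = Q x i" if "i \<le> m" for i
        unfolding Q_def using eq that by (intro prod.cong) auto
      have PP: "P y m = P x m"
        unfolding P_def using eq QQ by (intro sum.cong) auto
      let ?I = "\<lambda>z. P x m + Q x m * pos (dg z m)"
      have Ix: "?I x \<le> T x \<and> T x \<le> ?I x + Q x m * q (dg x m)"
        using T[OF x, of "Suc m"] by (simp add: P_Suc Q_Suc)
      have Iy: "?I y \<le> T y \<and> T y \<le> ?I y + Q x m * q (dg y m)"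
        using T[OF y, of "Suc m"] by (simp add: P_Suc Q_Suc QQ PP)
      have "Q x m * \<eta> \<le> \<bar>T x - T y\<bar>"
        using gap[OF dg[OF x] dg[OF y] ne]
      proof
        assume "pos (dg x m) + q (dg x m) + \<eta> \<le> pos (dg y m)"
        then have "Q x m * (pos (dg x m) + q (dg x m) + \<eta>) \<le> Q x m * pos (dg y m)"
          using Q0[OF x] by (rule mult_left_mono)
        then show ?thesis using Ix Iy unfolding distrib_left by linarith
      next
        assume "pos (dg y m) + q (dg y m) + \<eta> \<le> pos (dg x m)"
        then have "Q x m * (pos (dg y m) + q (dg y m) + \<eta>) \<le> Q x m * pos (dg x m)"
          using Q0[OF x] by (rule mult_left_mono)
        then show ?thesis using Ix Iy unfolding distrib_left by linarith
      qed
      moreover have "c / 3 ^ m * \<eta> \<le> Q x m * \<eta>"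
        using low[OF x, of m] \<open>0 < \<eta>\<close> unfolding Q_def by (intro mult_right_mono) auto
      ultimately have "M / (c * \<eta>) * (c / 3 ^ m * \<eta>) \<le> M / (c * \<eta>) * \<bar>T x - T y\<bar>"
        using assms(4-6) by (intro mult_left_mono) auto
      moreover have "M / (c * \<eta>) * (c / 3 ^ m * \<eta>) = M / 3 ^ m"
        using assms(4-6) by (simp add: field_simps)
      ultimately show ?thesis
        using near[OF x y eq] by linarith
    qed
  qed
qed

section \<open>The curve through the central points\<close>

text \<open>
  The distinguished letter takes the first half of the unit interval. The others are enumerated by \<open>e\<close>
  and placed in the second half, alternating with gaps of their own length \<open>\<eta>\<close>; the value of \<open>\<eta>\<close> leaves
  room for an interval and a gap for each letter.
\<close>

lemma letter_intervals:
  fixes D :: "'l set"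
  assumes "finite D" "c0 \<in> D"
  defines "\<eta> \<equiv> 1 / (4 * real (card D))"
  obtains pos q :: "'l \<Rightarrow> real" where "\<And>a. q a = (if a = c0 then 1 / 2 else \<eta>)"
    "\<And>a. a \<in> D \<Longrightarrow> 0 \<le> pos a \<and> pos a + q a \<le> 1"
    "\<And>a b. a \<in> D \<Longrightarrow> b \<in> D \<Longrightarrow> a \<noteq> b \<Longrightarrow> pos a + q a + \<eta> \<le> pos b \<or> pos b + q b + \<eta> \<le> pos a"
proof -
  obtain e where e: "bij_betw e D {0..<card D}"
    using ex_bij_betw_finite_nat[OF assms(1)] by blast
  have card: "1 \<le> card D"
    using assms(1,2) by (simp add: Suc_le_eq card_gt_0_iff) blast
  have \<eta>: "0 < \<eta>" "4 * real (card D) * \<eta> = 1"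
    using card by (auto simp: \<eta>_def)
  define q where "q a = (if a = c0 then 1 / 2 else \<eta>)" for a
  define pos where "pos a = (if a = c0 then 0 else 1 / 2 + \<eta> * (2 * real (e a) + 1))" for a
  have ge: "1 / 2 + \<eta> \<le> pos b" if "b \<noteq> c0" for b
    using that \<eta>(1) by (simp add: pos_def)
  show thesis
  proof
    fix a show "q a = (if a = c0 then 1 / 2 else \<eta>)" by (fact q_def)
  next
    fix a assume a: "a \<in> D"
    show "0 \<le> pos a \<and> pos a + q a \<le> 1"
    proof (cases "a = c0")
      case False
      have "e a < card D"
        using bij_betwE[OF e] a by auto
      then have "2 * real (e a) + 2 \<le> 2 * real (card D)" by linarith
      then have "\<eta> * (2 * real (e a) + 2) \<le> \<eta> * (2 * real (card D))"
        using \<eta>(1) by (intro mult_left_mono) auto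
      then show ?thesis
        using False \<eta> by (simp add: pos_def q_def algebra_simps)
    qed (simp add: pos_def q_def)
  next
    fix a b assume ab: "a \<in> D" "b \<in> D" "a \<noteq> b"
    have other: "pos a + q a + \<eta> \<le> pos b" if "a \<noteq> c0" "b \<noteq> c0" "e a < e b" for a b
    proof -
      have "2 * real (e a) + 2 \<le> 2 * real (e b)" using that(3) by linarith
      then have "\<eta> * (2 * real (e a) + 2) \<le> \<eta> * (2 * real (e b))"
        using \<eta>(1) by (intro mult_left_mono) auto
      then show ?thesis
        using that by (simp add: pos_def q_def algebra_simps)
    qed
    have "e a \<noteq> e b"
      using ab bij_betw_imp_inj_on[OF e] by (auto dest: inj_onD)
    then consider "a = c0" | "b = c0" | "a \<noteq> c0" "b \<noteq> c0" "e a < e b" | "a \<noteq> c0" "b \<noteq> c0" "e b < e a"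
      by linarith
    then show "pos a + q a + \<eta> \<le> pos b \<or> pos b + q b + \<eta> \<le> pos a"
    proof cases
      case 1
      then show ?thesis using ge[of b] ab by (simp add: pos_def q_def)
    next
      case 2
      then show ?thesis using ge[of a] ab by (simp add: pos_def q_def)
    qed (use other in blast)+
  qed
qed

text \<open>
  In the nested interval coding of digit vectors, the central letter has relative length \<open>1 / 2\<close> and
  every other letter has \<open>1 / (4 * N)\<close>. The price \<open>f\<close> is chosen so that the relative length of a letter is at
  least \<open>1 / 2\<close> divided by the product of the prices of its digits. A price of at most \<open>C * r ^ m\<close> in
  each coordinate therefore leaves an interval of length at least
  \<open>(2 * r ^ d) ^ (-m) / C ^ d\<close>, and \<open>2 * r ^ d \<le> 3\<close>.
\<close>

lemma rectifiable_curve_covers_central_set: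
  fixes r :: real and A :: "real set"
  defines "N \<equiv> (3::real) ^ CARD('n::finite)"
  defines "f \<equiv> (\<lambda>i::int. if i = 1 then 1 else 2 * N)"
  assumes A: "A \<subseteq> {0<..1}" and "0 < C" and r: "0 < r" "r ^ CARD('n) \<le> 3 / 2"
    and bound: "\<And>x m. x \<in> A \<Longrightarrow> digit_prod f m (cell_index m x) \<le> C * r ^ m"
  obtains \<gamma> :: "real \<Rightarrow> real ^ 'n" where "rectifiable_curve \<gamma>" "{x. \<forall>i. x $ i \<in> A} \<subseteq> path_image \<gamma>"
proof -
  let ?d = "CARD('n)"
  define K where "K = {x :: real ^ 'n. \<forall>i. x $ i \<in> A}"
  define D where "D = (UNIV :: 'n set) \<rightarrow>\<^sub>E {0, 1, 2 :: int}"
  define c0 where "c0 = (\<lambda>_::'n. 1::int)"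
  define dg where "dg x j = (\<lambda>i. cell_index (Suc j) (x $ i) mod 3)" for x :: "real ^ 'n" and j
  have "finite D" "c0 \<in> D" by (auto simp: D_def c0_def finite_PiE)
  have "card D = 3 ^ ?d" by (simp add: D_def card_PiE numeral_3_eq_3)
  then have card: "real (card D) = N" by (simp add: N_def)
  have N: "1 \<le> N" by (simp add: N_def)
  obtain pos q :: "('n \<Rightarrow> int) \<Rightarrow> real" where
    q: "\<And>a. q a = (if a = c0 then 1 / 2 else 1 / (4 * N))" and
    pos: "\<And>a. a \<in> D \<Longrightarrow> 0 \<le> pos a \<and> pos a + q a \<le> 1" and
    gap: "\<And>a b. a \<in> D \<Longrightarrow> b \<in> D \<Longrightarrow> a \<noteq> b \<Longrightarrow>
      pos a + q a + 1 / (4 * N) \<le> pos b \<or> pos b + q b + 1 / (4 * N) \<le> pos a"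
    by (rule letter_intervals[OF \<open>finite D\<close> \<open>c0 \<in> D\<close>, unfolded card]) (rule that)
  have f1: "1 \<le> f i" and f0: "0 < f i" for i using N by (simp_all add: f_def)
  have q_lower: "1 \<le> q a * (2 * (\<Prod>i\<in>UNIV. f (a i)))" for a
  proof (cases "a = c0")
    case True
    then show ?thesis by (simp add: q c0_def f_def)
  next
    case False
    then obtain i where "a i \<noteq> 1" by (auto simp: c0_def)
    then have "2 * N = f (a i)" by (simp add: f_def)
    also have "\<dots> \<le> (\<Prod>i\<in>UNIV. f (a i))"
    proof -
      have "f (a i) * 1 \<le> f (a i) * (\<Prod>i\<in>UNIV - {i}. f (a i))"
        by (intro mult_left_mono prod_ge_1 f1 less_imp_le[OF f0])
      then show ?thesis by (simp add: prod.remove[of UNIV i])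
    qed
    finally show ?thesis
      using False N by (simp add: q field_simps)
  qed
  have qpos: "0 < q a" "q a \<le> 1 / 2" for a
    using N by (auto simp: q field_simps)
  have low: "(1 / C ^ ?d) / 3 ^ m \<le> (\<Prod>j<m. q (dg x j))" if "x \<in> K" for x m
  proof -
    have "1 \<le> (\<Prod>j<m. q (dg x j) * (2 * (\<Prod>i\<in>UNIV. f (dg x j i))))"
      by (intro prod_ge_1 q_lower)
    also have "\<dots> = (\<Prod>j<m. q (dg x j)) * (2 ^ m * (\<Prod>i\<in>UNIV. digit_prod f m (cell_index m (x $ i))))"
      unfolding prod.distrib digit_prod_cell_index dg_def by (subst prod.swap) simp
    also have "\<dots> \<le> (\<Prod>j<m. q (dg x j)) * (2 ^ m * (\<Prod>i\<in>(UNIV::'n set). C * r ^ m))"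
    proof -
      have "0 \<le> digit_prod f m k" for k
        by (intro less_imp_le digit_prod_pos f0)
      then show ?thesis
        using that bound qpos(1) by (intro mult_left_mono prod_mono prod_nonneg) (auto simp: K_def less_imp_le)
    qed
    also have "\<dots> = (\<Prod>j<m. q (dg x j)) * (C ^ ?d * (2 * r ^ ?d) ^ m)"
      by (simp add: power_mult_distrib mult_ac flip: power_mult)
    also have "\<dots> \<le> (\<Prod>j<m. q (dg x j)) * (C ^ ?d * 3 ^ m)"
      using qpos(1) r \<open>0 < C\<close> by (intro mult_left_mono power_mono prod_nonneg) (auto simp: less_imp_le)
    finally show ?thesis
      using \<open>0 < C\<close> by (simp add: field_simps)
  qed
  have near: "dist x y \<le> real ?d / 3 ^ m"
    if "x \<in> K" "y \<in> K" "\<forall>j<m. dg x j = dg y j" for x y m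
  proof -
    have index0: "cell_index 0 (z $ i) = 0" if "z \<in> K" for z i
    proof -
      have "z $ i \<in> {0<..1}" using that A by (auto simp: K_def)
      then have "\<lceil>z $ i\<rceil> = 1" by (intro ceiling_unique) auto
      then show ?thesis by (simp add: cell_index_def)
    qed
    have "dist (x $ i) (y $ i) \<le> 1 / 3 ^ m" for i
      unfolding dist_real_def
    proof (rule abs_diff_le_of_cell_index_eq[OF cell_index_eqI])
      show "cell_index 0 (x $ i) = cell_index 0 (y $ i)"
        using index0 that by simp
      show "cell_index (Suc j) (x $ i) mod 3 = cell_index (Suc j) (y $ i) mod 3" if "j < m" for j
        using \<open>\<forall>j<m. dg x j = dg y j\<close> that by (auto simp: dg_def fun_eq_iff)
    qed
    then have "(\<Sum>i\<in>UNIV. dist (x $ i) (y $ i)) \<le> real ?d * (1 / 3 ^ m)"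
      by (intro sum_bounded_above) auto
    then show ?thesis
      using dist_vec_le_sum[of x y] by simp
  qed
  have dg: "dg x j \<in> D" for x j
  proof -
    have "k mod 3 \<in> {0, 1, 2}" for k :: int
      by auto
    then show ?thesis
      by (simp add: D_def dg_def PiE_UNIV_domain)
  qed
  obtain T where T: "\<And>x. x \<in> K \<Longrightarrow> T x \<in> {0..1}"
    "\<And>x y. x \<in> K \<Longrightarrow> y \<in> K \<Longrightarrow> dist x y \<le> real ?d / (1 / C ^ ?d * (1 / (4 * N))) * \<bar>T x - T y\<bar>"
  proof (rule digit_code_separates[of D q pos "1 / (4 * N)" "1 / C ^ ?d" "real ?d" K dg])
    show "0 < q a \<and> q a \<le> 1 / 2" for a
      using qpos by blast
    show "0 < 1 / (4 * N)" "0 < 1 / C ^ ?d" "0 \<le> real ?d"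
      using N \<open>0 < C\<close> by auto
  qed (rule pos gap dg near low that; assumption)+
  obtain \<gamma> where "rectifiable_curve \<gamma>" "K \<subseteq> path_image \<gamma>"
    using rectifiable_curve_covers[OF T(1) _ T(2)] N \<open>0 < C\<close> by auto
  then show thesis
    using that unfolding K_def by blast
qed

theorem theorem1p1:
  assumes "CARD('n::finite) \<ge> 2"
  shows "\<exists>(\<nu> :: (real ^ 'n) measure) (\<gamma> :: real \<Rightarrow> real ^ 'n).
           doubling_measure \<nu> \<and> rectifiable_curve \<gamma> \<and>
           emeasure \<nu> (path_image \<gamma>) > 0"
proof -
  let ?d = "CARD('n)"
  define N where "N = (3::real) ^ ?d"
  have N: "1 \<le> N" by (simp add: N_def)
  define r where "r = root ?d (3 / 2)"
  have r: "1 < r" "r ^ ?d = 3 / 2"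
    by (simp_all add: r_def)
  \<comment> \<open>The mean price of a digit is \<open>1 - 2\<delta> + 4N\<delta>\<close>, which has to stay below \<open>r\<close>.\<close>
  define \<delta> where "\<delta> = min (1 / 4) ((r - 1) / (8 * N))"
  have delta: "0 < \<delta>" "\<delta> < 1 / 3" "\<delta> * (8 * N) \<le> r - 1"
    using r N by (auto simp: \<delta>_def min_def field_simps)
  define f where "f = (\<lambda>i::int. if i = 1 then 1 else 2 * N)"
  have "\<delta> * f 0 + (1 - 2 * \<delta>) * f 1 + \<delta> * f 2 < r"
  proof -
    have "\<delta> * f 0 + (1 - 2 * \<delta>) * f 1 + \<delta> * f 2 = 1 + \<delta> * (8 * N) / 2 - 2 * \<delta>"
      by (simp add: f_def algebra_simps)
    also have "\<dots> < r"
      using delta r by linarith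
    finally show ?thesis .
  qed
  moreover have "0 < f i" for i using N by (simp add: f_def)
  ultimately obtain A C where A: "A \<in> sets borel" "A \<subseteq> {0<..1}" "0 < emeasure (cascade \<delta>) A" "0 < C"
    "\<And>x m. x \<in> A \<Longrightarrow> digit_prod f m (cell_index m x) \<le> C * r ^ m"
    using digit_prod_bounded_on_positive_set[OF delta(1,2)] by blast
  obtain \<gamma> :: "real \<Rightarrow> real ^ 'n" where \<gamma>: "rectifiable_curve \<gamma>" "{x. \<forall>i. x $ i \<in> A} \<subseteq> path_image \<gamma>"
    using rectifiable_curve_covers_central_set[where 'n = 'n, of A C r] A r
    unfolding f_def N_def by auto
  let ?\<nu> = "vec_product_measure (cascade \<delta>) :: (real ^ 'n) measure"
  have "emeasure ?\<nu> {x. \<forall>i. x $ i \<in> A} = (\<Prod>i\<in>(UNIV::'n set). emeasure (cascade \<delta>) A)"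
    using A(1) by (intro emeasure_vec_product_measure sigma_finite_cascade delta(1,2)) auto
  also have "\<dots> > 0"
    using A(3) by (simp add: zero_less_iff_neq_zero)
  finally have "0 < emeasure ?\<nu> {x. \<forall>i. x $ i \<in> A}" .
  also have "\<dots> \<le> emeasure ?\<nu> (path_image \<gamma>)"
  proof (rule emeasure_mono[OF \<gamma>(2)])
    have "closed (path_image \<gamma>)"
      using \<gamma>(1) by (intro closed_path_image) (simp add: rectifiable_curve_def)
    then show "path_image \<gamma> \<in> sets ?\<nu>"
      by (simp add: vec_product_measure_def)
  qed
  finally show ?thesis
    using doubling_measure_cascade[OF delta(1,2)] \<gamma>(1) by blast
qed

end
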